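(* Let $\overline{E}[\cdot]=\sup_{P\in\mathcal{P}}E_P[\cdot]$ be a sublinear expectation on the space $(\Omega,\mathcal{H},\overline{E})$ described in the context. Let $\{X_n\}_{n=1}^\infty\subset\mathcal{H}$ be a sequence of random variables that is IID under $\overline{E}$, and put $S_0:=0$, $S_n:=\sum_{i=1}^n X_i$ for $n\ge 1$. Assume that $\overline{E}[X_1]=\overline{E}[-X_1]=0$. Then for each real $r>2$ there exists a positive constant $K_r$, not depending on $n$, such that for all positive integers $n$, $$\sup_{m\geq 0}\overline{E}\big[|S_{m+n}-S_m|^r\big]\leq K_r\, n^{r/2},$$ where the supremum is over all integers $m\ge 0$.
   Context: Setting. $(\Omega,\mathcal{F})$ is a measurable space, $\mathcal{P}$ is a nonempty set of probability measures on it, and $E_P$ denotes the classical expectation under $P$. $\mathcal{H}$ is a linear space of real-valued random variables on $(\Omega,\mathcal{F})$ that contains all constants, satisfies $|X|\in\mathcal{H}$ whenever $X\in\mathcal{H}$, and satisfies: if $X_1,\dots,X_n\in\mathcal{H}$ then $\varphi(X_1,\dots,X_n)\in\mathcal{H}$ for each $\varphi\in C_{l,Lip}(\mathbb{R}^n)$. Here $C_{l,Lip}(\mathbb{R}^n)$ is the space of functions $\varphi:\mathbb{R}^n\to\mathbb{R}$ such that $|\varphi(x)-\varphi(y)|\le C(1+|x|^m+|y|^m)|x-y|$ for all $x,y\in\mathbb{R}^n$, for some $C>0$ and $m\in\mathbb{N}$ depending on $\varphi$. The functional $\overline{E}[\xi]:=\sup_{P\in\mathcal{P}}E_P[\xi]$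 is assumed to be real-valued (finite) on $\mathcal{H}$; it is a sublinear expectation, i.e. it is monotone, constant preserving, sub-additive ($\overline{E}[X]-\overline{E}[Y]\le\overline{E}[X-Y]$) and positively homogeneous. Independence. For $Y_1,\dots,Y_n\in\mathcal{H}$, the random variable $Y_n$ is said to be independent of $X:=(Y_1,\dots,Y_{n-1})$ under $\overline{E}$ if for each measurable function $\varphi$ on $\mathbb{R}^n$ with $\varphi(X,Y_n)\in\mathcal{H}$ and $\varphi(x,Y_n)\in\mathcal{H}$ for each $x\in\mathbb{R}^{n-1}$, one has $\overline{E}[\varphi(X,Y_n)]=\overline{E}[\overline{\varphi}(X)]$, where $\overline{\varphi}(x):=\overline{E}[\varphi(x,Y_n)]$ and $\overline{\varphi}(X)\in\mathcal{H}$. Identical distribution. $X,Y\in\mathcal{H}$ are identically distributed, $X\sim Y$, if $\overline{E}[\varphi(X)]=\overline{E}[\varphi(Y)]$ for each measurable function $\varphi$ such that $\varphi(X),\varphi(Y)\in\mathcal{H}$. IID. A sequence $\{X_i\}_{i=1}^\infty$ is IID under $\overline{E}$ if $X_i\sim X_1$ and $X_{i+1}$ is independent of $(X_1,\dots,X_i)$ for each $i\ge1$. *)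

theory Defs
  imports "HOL-Probability.Probability"
begin

text \<open>
  The upper expectation of a family of probability measures. It is only meant to be used for
  functions that are integrable under every member of \<open>Ps\<close> and whose expectations are bounded
  above; on the space \<open>H\<close> below both are part of the assumptions, so this real supremum of
  Lebesgue integrals is a genuine one there.
\<close>

definition upper_exp :: "'a measure set \<Rightarrow> ('a \<Rightarrow> real) \<Rightarrow> real" where
  "upper_exp Ps \<xi> = (SUP P\<in>Ps. integral\<^sup>L P \<xi>)"

text \<open>
  A point of $R^n$ is an extensional function on \<open>{1..n}\<close>, i.e. an element of
  \<open>{1..n} \<rightarrow>\<^sub>E UNIV\<close>, and the Borel sigma-algebra is the product sigma-algebra on these
  functions. Functions on $R^n$ are only ever inspected at such points.
\<close>

abbreviation borel_vec :: "nat \<Rightarrow> (nat \<Rightarrow> real) measure" where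
  "borel_vec n \<equiv> Pi\<^sub>M {1..n} (\<lambda>_. borel)"

definition euclid_norm :: "nat \<Rightarrow> (nat \<Rightarrow> real) \<Rightarrow> real" where
  "euclid_norm n x = sqrt (\<Sum>i=1..n. (x i)\<^sup>2)"

definition C_lLip :: "nat \<Rightarrow> ((nat \<Rightarrow> real) \<Rightarrow> real) set" where
  "C_lLip n = {\<phi>. \<exists>C>0. \<exists>m::nat. \<forall>x\<in>{1..n} \<rightarrow>\<^sub>E UNIV. \<forall>y\<in>{1..n} \<rightarrow>\<^sub>E UNIV.
     \<bar>\<phi> x - \<phi> y\<bar> \<le> C * (1 + euclid_norm n x ^ m + euclid_norm n y ^ m)
                     * euclid_norm n (\<lambda>i. x i - y i)}"

definition rvec :: "nat \<Rightarrow> (nat \<Rightarrow> 'a \<Rightarrow> real) \<Rightarrow> 'a \<Rightarrow> nat \<Rightarrow> real" where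
  "rvec n X \<omega> = (\<lambda>i\<in>{1..n}. X i \<omega>)"

text \<open>
  Random variables are total functions on \<open>'a\<close> of which only the values on \<open>space M\<close> matter;
  \<open>H_cong\<close> expresses exactly this identification.
\<close>

locale upper_expectation_space =
  fixes M :: "'a measure" and Ps :: "'a measure set" and H :: "('a \<Rightarrow> real) set"
  assumes Ps_nonempty: "Ps \<noteq> {}"
    and Ps_prob: "P \<in> Ps \<Longrightarrow> prob_space P"
    and Ps_sets: "P \<in> Ps \<Longrightarrow> sets P = sets M"
    and H_measurable: "X \<in> H \<Longrightarrow> X \<in> borel_measurable M"
    and H_cong: "X \<in> H \<Longrightarrow> (\<And>\<omega>. \<omega> \<in> space M \<Longrightarrow> Y \<omega> = X \<omega>) \<Longrightarrow> Y \<in> H"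
    and H_const: "(\<lambda>_. c) \<in> H"
    and H_add: "X \<in> H \<Longrightarrow> Y \<in> H \<Longrightarrow> (\<lambda>\<omega>. X \<omega> + Y \<omega>) \<in> H"
    and H_scale: "X \<in> H \<Longrightarrow> (\<lambda>\<omega>. c * X \<omega>) \<in> H"
    and H_abs: "X \<in> H \<Longrightarrow> (\<lambda>\<omega>. \<bar>X \<omega>\<bar>) \<in> H"
    and H_lLip: "(\<And>i. i \<in> {1..n} \<Longrightarrow> Z i \<in> H) \<Longrightarrow> \<phi> \<in> C_lLip n \<Longrightarrow>
                   (\<lambda>\<omega>. \<phi> (rvec n Z \<omega>)) \<in> H"
    and H_integrable: "X \<in> H \<Longrightarrow> P \<in> Ps \<Longrightarrow> integrable P X"
    and H_bdd: "X \<in> H \<Longrightarrow> bdd_above ((\<lambda>P. integral\<^sup>L P X) ` Ps)"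

text \<open>
  \<open>Y\<close> is independent of \<open>(X 1, \<dots>, X k)\<close>. For a point \<open>x\<close> of $R^k$, the update
  \<open>x(Suc k := y)\<close> is the point $(x,y)$ of $R^{k+1}$.
\<close>

definition independent_of ::
    "'a measure set \<Rightarrow> ('a \<Rightarrow> real) set \<Rightarrow> nat \<Rightarrow> (nat \<Rightarrow> 'a \<Rightarrow> real) \<Rightarrow> ('a \<Rightarrow> real) \<Rightarrow> bool" where
  "independent_of Ps H k X Y \<longleftrightarrow>
     (\<forall>\<phi>\<in>borel_measurable (borel_vec (Suc k)).
        (\<lambda>\<omega>. \<phi> ((rvec k X \<omega>)(Suc k := Y \<omega>))) \<in> H \<longrightarrow>
        (\<forall>x\<in>{1..k} \<rightarrow>\<^sub>E UNIV. (\<lambda>\<omega>. \<phi> (x(Suc k := Y \<omega>))) \<in> H) \<longrightarrow>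
        (let \<phi>' = (\<lambda>x. upper_exp Ps (\<lambda>\<omega>. \<phi> (x(Suc k := Y \<omega>))))
         in (\<lambda>\<omega>. \<phi>' (rvec k X \<omega>)) \<in> H \<and>
            upper_exp Ps (\<lambda>\<omega>. \<phi> ((rvec k X \<omega>)(Suc k := Y \<omega>))) =
            upper_exp Ps (\<lambda>\<omega>. \<phi>' (rvec k X \<omega>))))"

definition identically_distributed ::
    "'a measure set \<Rightarrow> ('a \<Rightarrow> real) set \<Rightarrow> ('a \<Rightarrow> real) \<Rightarrow> ('a \<Rightarrow> real) \<Rightarrow> bool" where
  "identically_distributed Ps H X Y \<longleftrightarrow>
     (\<forall>\<phi>\<in>borel_measurable borel.
        (\<lambda>\<omega>. \<phi> (X \<omega>)) \<in> H \<longrightarrow> (\<lambda>\<omega>. \<phi> (Y \<omega>)) \<in> H \<longrightarrow>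
        upper_exp Ps (\<lambda>\<omega>. \<phi> (X \<omega>)) = upper_exp Ps (\<lambda>\<omega>. \<phi> (Y \<omega>)))"

text \<open>Sequences are indexed from 1; the value \<open>X 0\<close> is never used.\<close>

definition iid :: "'a measure set \<Rightarrow> ('a \<Rightarrow> real) set \<Rightarrow> (nat \<Rightarrow> 'a \<Rightarrow> real) \<Rightarrow> bool" where
  "iid Ps H X \<longleftrightarrow>
     (\<forall>i\<ge>1. identically_distributed Ps H (X i) (X 1) \<and> independent_of Ps H i X (X (Suc i)))"

definition partial_sum :: "(nat \<Rightarrow> 'a \<Rightarrow> real) \<Rightarrow> nat \<Rightarrow> 'a \<Rightarrow> real" where
  "partial_sum X n \<omega> = (\<Sum>i=1..n. X i \<omega>)"

end

theory Submission
  imports Defs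
begin

text \<open>
  Write $a_n$ for the upper expectation of $|S_{m+n}-S_m|^r$. As in the classical proof for
  independent centred summands, the increment $a_{n+1}-a_n$ is estimated by a second-order
  expansion of $|s+y|^r$ in the new summand $y$. Its linear term vanishes:
  the two conditions on the mean of $X_1$ say that every $E_P[X_1]$ is both $\le 0$ and $\ge 0$;
  by identical distribution each $X_i$ has mean $0$ under each single measure $P$, and multiples of $X_i$ of either sign
  contribute nothing to a sublinear expectation.

  The quadratic term $|s|^{r-2}y^2$ is not passed to lower moments of the block sum.
  Instead, Young's inequality with a weight depending on $n$ splits it into $|s|^r/n$ and a
  multiple of $n^{r/2-1}|y|^r$ (\<open>powr_mult_square_le\<close>), which gives the pointwise bound
  \<open>abs_powr_add_le\<close>
  \[ |s+y|^r \le (1+1/n)\,|s|^r + r\,\mathrm{sgn}(s)\,|s|^{r-1}y + C\,n^{r/2-1}\,|y|^r . \]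
  Freezing $s$, taking the upper expectation in $y$ and then using independence yields
  \[ a_{n+1} \le (1+1/n)\,a_n + C\rho\, n^{r/2-1}, \]
  where $\rho$ is the upper expectation of $|X_1|^r$, and $a_1=\rho$. A sequence satisfying this recursion
  is at most $K n^{r/2}$, because $(n+1)^{r/2}$ exceeds $n^{r/2}$ by at least $(r/2)n^{r/2-1}$
  while the factor $1+1/n$ uses up only $n^{r/2-1}$ of this; the gap $r/2-1>0$ absorbs the
  remaining term (\<open>growth_from_recursion\<close>). The constants depend only on $r$ and $\rho$, hence
  not on $m$.
\<close>

section \<open>Power inequalities\<close>

text \<open>
  Convexity of the power function. This tangent inequality replaces all differential calculus
  below: it yields the second-order expansion, the local Lipschitz estimate for $|x|^r$, and the
  lower bound for the growth of $n^{r/2}$.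
\<close>

lemma powr_above_tangent:
  fixes a b p :: real
  assumes "a \<ge> 0" "b \<ge> 0" "p \<ge> 1"
  shows "a powr p + p * a powr (p - 1) * (b - a) \<le> b powr p"
proof -
  consider "a = 0" | "a > 0" "b = 0" | "a > 0" "b > 0"
    using assms by linarith
  then show ?thesis
  proof cases
    case 2
    have "a powr (p - 1) * a = a powr p"
      using 2 by (simp add: powr_mult_base mult.commute)
    moreover have "0 \<le> (p - 1) * a powr p"
      using assms by simp
    ultimately show ?thesis
      using 2 by (simp add: algebra_simps)
  next
    case 3
    have "b powr p - a powr p \<ge> p * a powr (p - 1) * (b - a)"
    proof (rule convex_on_imp_above_tangent[of "{0<..}"])
      show "convex_on {0<..} (\<lambda>x. x powr p)"
        using assms by (intro powr_convex)
      show "((\<lambda>x. x powr p) has_real_derivative p * a powr (p - 1)) (at a within {0<..})"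
        using 3 by (auto intro!: derivative_eq_intros)
    qed (use 3 in \<open>auto simp: interior_open\<close>)
    then show ?thesis
      by simp
  qed (use assms in auto)
qed

text \<open>
  A second-order Taylor bound near $u$. The tangent at $u+v$ gives
  $(u+v)^r\le u^r+rv(u+v)^{r-1}$, and a second tangent inequality, for the exponent $r-1$, compares
  $(u+v)^{r-1}$ with $u^{r-1}$.
\<close>

lemma powr_add_le:
  fixes u v r :: real
  assumes "r > 2" "u > 0" "\<bar>v\<bar> \<le> u / 2"
  shows "(u + v) powr r
           \<le> u powr r + r * u powr (r - 1) * v + r * (r - 1) * 2 powr (r - 2) * u powr (r - 2) * v\<^sup>2"
proof -
  have uv: "u + v \<ge> 0" "u + v \<le> 2 * u"
    using assms by auto
  have "(u + v) powr r \<le> u powr r + r * ((u + v) powr (r - 1) * v)"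
    using powr_above_tangent[of "u + v" u r] assms uv by (simp add: algebra_simps)
  moreover have "((u + v) powr (r - 1) - u powr (r - 1)) * v
                   \<le> (r - 1) * (2 powr (r - 2) * u powr (r - 2)) * v\<^sup>2"
  proof (cases "v \<ge> 0")
    case True
    have "(u + v) powr (r - 1) - u powr (r - 1) \<le> (r - 1) * (u + v) powr (r - 2) * v"
      using powr_above_tangent[of "u + v" u "r - 1"] assms uv by (simp add: algebra_simps)
    also have "\<dots> \<le> (r - 1) * (2 * u) powr (r - 2) * v"
      using assms uv True by (intro mult_right_mono mult_left_mono powr_mono2) auto
    finally have "((u + v) powr (r - 1) - u powr (r - 1)) * v \<le> ((r - 1) * (2 * u) powr (r - 2) * v) * v"
      using True by (intro mult_right_mono)
    then show ?thesis
      using assms by (simp add: powr_mult power2_eq_square mult.assoc)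
  next
    case False
    have "(r - 1) * u powr (r - 2) * v \<le> (u + v) powr (r - 1) - u powr (r - 1)"
      using powr_above_tangent[of u "u + v" "r - 1"] assms uv by (simp add: algebra_simps)
    then have "((u + v) powr (r - 1) - u powr (r - 1)) * v \<le> ((r - 1) * u powr (r - 2) * v) * v"
      using False by (intro mult_right_mono_neg) auto
    also have "\<dots> = ((r - 1) * u powr (r - 2) * v\<^sup>2) * 1"
      by (simp add: power2_eq_square)
    also have "\<dots> \<le> ((r - 1) * u powr (r - 2) * v\<^sup>2) * 2 powr (r - 2)"
      using assms by (intro mult_left_mono ge_one_powr_ge_zero) auto
    finally show ?thesis
      by (simp add: mult_ac)
  qed
  then have "r * (((u + v) powr (r - 1) - u powr (r - 1)) * v)
      \<le> r * ((r - 1) * (2 powr (r - 2) * u powr (r - 2)) * v\<^sup>2)"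
    using assms by (intro mult_left_mono) auto
  ultimately show ?thesis
    by (simp add: algebra_simps)
qed

text \<open>
  Young's inequality for the exponents $r/(r-2)$ and $r/2$, with the weight $1/n$ on $u^r$. Each of
  the two summands alone is large enough on its side of the threshold $u^2 = Anv^2$.
\<close>

lemma powr_mult_square_le:
  fixes A n u v r :: real
  assumes "r > 2" "A \<ge> 0" "n > 0" "u > 0"
  shows "A * u powr (r - 2) * v\<^sup>2 \<le> u powr r / n + A powr (r / 2) * n powr (r / 2 - 1) * \<bar>v\<bar> powr r"
proof (cases "A * n * v\<^sup>2 \<le> u\<^sup>2")
  case True
  have "A * u powr (r - 2) * v\<^sup>2 = u powr (r - 2) * (A * n * v\<^sup>2) / n"
    using assms by simp
  also have "\<dots> \<le> u powr (r - 2) * u\<^sup>2 / n"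
    using True assms by (intro divide_right_mono mult_left_mono) auto
  also have "u powr (r - 2) * u\<^sup>2 = u powr r"
    using assms by (simp add: powr_diff)
  finally show ?thesis
    using assms by (smt (verit) mult_nonneg_nonneg powr_ge_zero)
next
  case False
  then have v: "v \<noteq> 0" and A: "A > 0"
    using assms by (auto simp: zero_less_mult_iff not_le less_eq_real_def)
  have "u powr (r - 2) = (u\<^sup>2) powr (r / 2 - 1)"
    using assms by (simp add: powr_powr algebra_simps flip: powr_numeral)
  also have "\<dots> \<le> (A * n * v\<^sup>2) powr (r / 2 - 1)"
    using False assms by (intro powr_mono2) auto
  also have "\<dots> = A powr (r / 2 - 1) * n powr (r / 2 - 1) * (\<bar>v\<bar>\<^sup>2) powr (r / 2 - 1)"
    using assms by (simp add: powr_mult)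
  also have "(\<bar>v\<bar>\<^sup>2) powr (r / 2 - 1) = \<bar>v\<bar> powr (r - 2)"
    using v by (simp add: powr_powr algebra_simps del: power2_abs flip: powr_numeral)
  finally have "A * u powr (r - 2) * v\<^sup>2
      \<le> A * (A powr (r / 2 - 1) * n powr (r / 2 - 1) * \<bar>v\<bar> powr (r - 2)) * v\<^sup>2"
    using assms by (intro mult_right_mono mult_left_mono) auto
  also have "\<dots> = (A powr (r / 2 - 1) * A) * n powr (r / 2 - 1) * (\<bar>v\<bar> powr (r - 2) * \<bar>v\<bar>\<^sup>2)"
    by simp
  also have "A powr (r / 2 - 1) * A = A powr (r / 2)"
    using A by (simp add: powr_diff)
  also have "\<bar>v\<bar> powr (r - 2) * \<bar>v\<bar>\<^sup>2 = \<bar>v\<bar> powr r"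
    using v by (simp add: powr_diff del: power2_abs)
  finally show ?thesis
    using assms by (smt (verit) divide_nonneg_pos powr_ge_zero)
qed

text \<open>
  The pointwise inequality behind the recursion for the moments. What matters is that the constant
  $C$ serves all $n$ at once, and that the coefficient of $|s|^r$ exceeds $1$ by only $1/n$.
\<close>

lemma abs_powr_add_le:
  fixes r :: real
  assumes "r > 2"
  obtains C where "C \<ge> 0"
    and "\<And>n s y. n \<ge> 1 \<Longrightarrow> \<bar>s + y\<bar> powr r
           \<le> (1 + 1 / n) * \<bar>s\<bar> powr r + r * sgn s * \<bar>s\<bar> powr (r - 1) * y
             + C * n powr (r / 2 - 1) * \<bar>y\<bar> powr r"
proof -
  define A where "A = r * (r - 1) * 2 powr (r - 2)"
  define C where "C = A powr (r / 2) + (3 powr r + r * 2 powr (r - 1))"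
  have A: "A \<ge> 0"
    using assms by (simp add: A_def)
  have "\<bar>s + y\<bar> powr r \<le> (1 + 1 / n) * \<bar>s\<bar> powr r + r * sgn s * \<bar>s\<bar> powr (r - 1) * y
             + C * n powr (r / 2 - 1) * \<bar>y\<bar> powr r" if n: "n \<ge> 1" for n s y :: real
  proof (cases "\<bar>y\<bar> \<le> \<bar>s\<bar> / 2")
    case True
    show ?thesis
    proof (cases "s = 0")
      case False
      \<comment> \<open>Reflecting so that $s$ becomes positive reduces this case to the expansion at $u>0$.\<close>
      define u v where "u = \<bar>s\<bar>" and "v = sgn s * y"
      have u: "u > 0" and v: "\<bar>v\<bar> = \<bar>y\<bar>" and uv: "\<bar>v\<bar> \<le> u / 2"
        using False True by (auto simp: u_def v_def abs_mult abs_sgn_eq)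
      have sy: "\<bar>s + y\<bar> = u + v"
        using False True by (auto simp: u_def v_def sgn_if)
      have "(u + v) powr r \<le> u powr r + r * u powr (r - 1) * v + A * u powr (r - 2) * v\<^sup>2"
        using powr_add_le[OF assms u uv] by (simp add: A_def)
      also have "A * u powr (r - 2) * v\<^sup>2
          \<le> u powr r / n + A powr (r / 2) * n powr (r / 2 - 1) * \<bar>v\<bar> powr r"
        using n by (intro powr_mult_square_le assms A u) auto
      also have "A powr (r / 2) * n powr (r / 2 - 1) * \<bar>v\<bar> powr r \<le> C * n powr (r / 2 - 1) * \<bar>v\<bar> powr r"
        using assms by (intro mult_right_mono) (auto simp: C_def)
      finally show ?thesis
        unfolding sy v by (simp add: u_def v_def algebra_simps)
    qed (use True assms in auto)
  next
    case False
    \<comment> \<open>Here $|s|<2|y|$, so every term, the linear one included, is at most a multiple of $|y|^r$.\<close>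
    have "\<bar>s + y\<bar> powr r \<le> (3 * \<bar>y\<bar>) powr r"
      using False assms by (intro powr_mono2) auto
    then have 1: "\<bar>s + y\<bar> powr r \<le> 3 powr r * \<bar>y\<bar> powr r"
      by (simp add: powr_mult)
    have "\<bar>r * sgn s * \<bar>s\<bar> powr (r - 1) * y\<bar> \<le> r * \<bar>s\<bar> powr (r - 1) * \<bar>y\<bar>"
      using assms by (auto simp: abs_mult abs_sgn_eq)
    also have "\<dots> \<le> r * (2 * \<bar>y\<bar>) powr (r - 1) * \<bar>y\<bar>"
      using assms False by (intro mult_right_mono mult_left_mono powr_mono2) auto
    also have "\<dots> = r * 2 powr (r - 1) * (\<bar>y\<bar> powr (r - 1) * \<bar>y\<bar>)"
      by (simp add: powr_mult)
    also have "\<bar>y\<bar> powr (r - 1) * \<bar>y\<bar> = \<bar>y\<bar> powr r"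
      using False by (simp add: powr_diff)
    finally have 2: "\<bar>r * sgn s * \<bar>s\<bar> powr (r - 1) * y\<bar> \<le> r * 2 powr (r - 1) * \<bar>y\<bar> powr r" .
    have "(3 powr r + r * 2 powr (r - 1)) * \<bar>y\<bar> powr r \<le> C * \<bar>y\<bar> powr r"
      by (intro mult_right_mono) (auto simp: C_def)
    also have "\<dots> \<le> C * n powr (r / 2 - 1) * \<bar>y\<bar> powr r"
    proof -
      have "1 \<le> n powr (r / 2 - 1)"
        using n assms by (intro ge_one_powr_ge_zero) auto
      moreover have "C \<ge> 0"
        using assms by (simp add: C_def)
      ultimately show ?thesis
        by (intro mult_right_mono) (auto simp: mult_le_cancel_left1)
    qed
    finally have 3: "(3 powr r + r * 2 powr (r - 1)) * \<bar>y\<bar> powr r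
        \<le> C * n powr (r / 2 - 1) * \<bar>y\<bar> powr r" .
    have "0 \<le> (1 + 1 / n) * \<bar>s\<bar> powr r"
      using n by simp
    then show ?thesis
      using 1 2 3 unfolding distrib_right by linarith
  qed
  moreover have "C \<ge> 0"
    using assms by (simp add: C_def)
  ultimately show thesis
    using that by blast
qed

text \<open>
  The induction closes because the discrete derivative of $n^{r/2}$ is at least
  $(r/2)n^{r/2-1}$: the term $n^{r/2}/n$ takes one unit of the coefficient $r/2$, and the lower bound
  $D/(r/2-1)$ for $K$ makes the rest sufficient for the term with $D$.
\<close>

lemma growth_from_recursion:
  fixes a :: "nat \<Rightarrow> real"
  assumes "r > 2" "D \<ge> 0" "a 1 \<le> \<rho>"
    and step: "\<And>n. n \<ge> 1 \<Longrightarrow> a (Suc n) \<le> (1 + 1 / n) * a n + D * n powr (r / 2 - 1)"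
    and K: "\<rho> \<le> K" "D / (r / 2 - 1) \<le> K"
    and "n \<ge> 1"
  shows "a n \<le> K * n powr (r / 2)"
  using \<open>n \<ge> 1\<close>
proof (induction n rule: nat_induct_at_least)
  case base
  show ?case
    using assms by simp
next
  case (Suc n)
  have K0: "K \<ge> 0"
    using assms by (meson divide_nonneg_pos diff_gt_0_iff_gt less_divide_eq_1_pos order_trans less_imp_le
      zero_less_numeral)
  have "D \<le> K * (r / 2 - 1)"
    using K(2) assms(1) by (simp add: pos_divide_le_eq)
  then have D: "D * n powr (r / 2 - 1) \<le> K * (r / 2 - 1) * n powr (r / 2 - 1)"
    by (intro mult_right_mono) auto
  have *: "n powr (r / 2) = n * n powr (r / 2 - 1)"
    using Suc by (simp add: powr_diff)
  have "a (Suc n) \<le> (1 + 1 / n) * a n + D * n powr (r / 2 - 1)"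
    by (rule step) fact
  also have "\<dots> \<le> (1 + 1 / n) * (K * n powr (r / 2)) + K * (r / 2 - 1) * n powr (r / 2 - 1)"
    using Suc by (intro add_mono D mult_left_mono) auto
  also have "\<dots> = K * (n powr (r / 2) + (r / 2) * n powr (r / 2 - 1) * (real (Suc n) - real n))"
    using Suc by (simp add: * field_simps)
  also have "\<dots> \<le> K * Suc n powr (r / 2)"
    using assms by (intro mult_left_mono powr_above_tangent K0) auto
  finally show ?case .
qed

text \<open>This is what places the $r$-th absolute moments within the domain of the upper expectation.\<close>

lemma abs_powr_C_lLip:
  fixes r :: real
  assumes "r \<ge> 1"
  shows "(\<lambda>x. \<bar>x 1\<bar> powr r) \<in> C_lLip 1"
proof -
  define m where "m = nat \<lceil>r - 1\<rceil>"
  have pow: "t powr (r - 1) \<le> 1 + t ^ m" if "t \<ge> 0" for t :: real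
  proof (cases "t \<le> 1")
    case True
    then have "t powr (r - 1) \<le> 1"
      using that assms by (intro powr_le1) auto
    with that show ?thesis
      by (smt (verit) zero_le_power)
  next
    case False
    then have "t powr (r - 1) \<le> t powr real m"
      unfolding m_def by (intro powr_mono) linarith+
    with False show ?thesis
      by (simp add: powr_realpow)
  qed
  have one: "a powr r - b powr r \<le> r * (1 + a ^ m + b ^ m) * \<bar>a - b\<bar>"
    if "a \<ge> 0" "b \<ge> 0" for a b :: real
  proof -
    have "a powr r - b powr r \<le> r * a powr (r - 1) * (a - b)"
      using powr_above_tangent[of a b r] that assms by (simp add: algebra_simps)
    also have "\<dots> \<le> r * a powr (r - 1) * \<bar>a - b\<bar>"
      using assms by (intro mult_left_mono) auto
    also have "\<dots> \<le> r * (1 + a ^ m + b ^ m) * \<bar>a - b\<bar>"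
      using pow[of a] that assms by (intro mult_right_mono mult_left_mono) (auto intro: order_trans)
    finally show ?thesis .
  qed
  have two: "\<bar>\<bar>a\<bar> powr r - \<bar>b\<bar> powr r\<bar> \<le> r * (1 + \<bar>a\<bar> ^ m + \<bar>b\<bar> ^ m) * \<bar>a - b\<bar>" for a b :: real
  proof -
    have "\<bar>\<bar>a\<bar> powr r - \<bar>b\<bar> powr r\<bar> \<le> r * (1 + \<bar>a\<bar> ^ m + \<bar>b\<bar> ^ m) * \<bar>\<bar>a\<bar> - \<bar>b\<bar>\<bar>"
      using one[of "\<bar>a\<bar>" "\<bar>b\<bar>"] one[of "\<bar>b\<bar>" "\<bar>a\<bar>"]
      by (simp add: abs_le_iff abs_minus_commute[of "\<bar>b\<bar>"] add_ac)
    also have "\<dots> \<le> r * (1 + \<bar>a\<bar> ^ m + \<bar>b\<bar> ^ m) * \<bar>a - b\<bar>"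
      using assms by (intro mult_left_mono) auto
    finally show ?thesis .
  qed
  have "euclid_norm 1 x = \<bar>x 1\<bar>" for x
    by (simp add: euclid_norm_def)
  then show ?thesis
    using two assms unfolding C_lLip_def by (intro CollectI exI[of _ r] exI[of _ m] conjI) auto
qed

section \<open>Upper expectations\<close>

context upper_expectation_space
begin

lemma space_Ps: "P \<in> Ps \<Longrightarrow> space P = space M"
  by (intro sets_eq_imp_space_eq Ps_sets)

lemma H_abs_powr:
  assumes "X \<in> H" "r \<ge> 1"
  shows "(\<lambda>\<omega>. \<bar>X \<omega>\<bar> powr r) \<in> H"
proof -
  have "(\<lambda>\<omega>. \<bar>rvec 1 (\<lambda>_. X) \<omega> 1\<bar> powr r) \<in> H"
    by (rule H_lLip[of 1 "\<lambda>_. X" "\<lambda>x. \<bar>x 1\<bar> powr r"]) (use assms abs_powr_C_lLip in auto)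
  then show ?thesis
    by (simp add: rvec_def)
qed

lemma H_sum: "finite I \<Longrightarrow> (\<And>i. i \<in> I \<Longrightarrow> X i \<in> H) \<Longrightarrow> (\<lambda>\<omega>. \<Sum>i\<in>I. X i \<omega>) \<in> H"
  by (induction I rule: finite_induct) (auto intro: H_const H_add)

lemma integral_le_upper_exp: "X \<in> H \<Longrightarrow> P \<in> Ps \<Longrightarrow> integral\<^sup>L P X \<le> upper_exp Ps X"
  unfolding upper_exp_def by (intro cSUP_upper H_bdd)

lemma upper_exp_le: "(\<And>P. P \<in> Ps \<Longrightarrow> integral\<^sup>L P X \<le> c) \<Longrightarrow> upper_exp Ps X \<le> c"
  unfolding upper_exp_def by (intro cSUP_least Ps_nonempty)

lemma upper_exp_nonneg:
  assumes "X \<in> H" "\<And>\<omega>. X \<omega> \<ge> 0"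
  shows "upper_exp Ps X \<ge> 0"
proof -
  obtain P where P: "P \<in> Ps"
    using Ps_nonempty by blast
  have "0 \<le> integral\<^sup>L P X"
    using assms by simp
  also have "\<dots> \<le> upper_exp Ps X"
    using assms P by (intro integral_le_upper_exp)
  finally show ?thesis .
qed

lemma upper_exp_affine_le:
  assumes "X \<in> H" "Y \<in> H" "\<beta> \<ge> 0" "\<And>\<omega>. \<omega> \<in> space M \<Longrightarrow> Y \<omega> \<le> \<alpha> + \<beta> * X \<omega>" 
  shows "upper_exp Ps Y \<le> \<alpha> + \<beta> * upper_exp Ps X"
proof (rule upper_exp_le)
  fix P assume P: "P \<in> Ps"
  interpret prob_space P
    using P by (rule Ps_prob)
  note [simp] = H_integrable[OF assms(1) P]
  have "integral\<^sup>L P Y \<le> (\<integral>\<omega>. \<alpha> + \<beta> * X \<omega> \<partial>P)"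
    using assms P by (intro integral_mono H_integrable H_add H_const H_scale) (auto simp: space_Ps)
  also have "\<dots> = \<alpha> + \<beta> * integral\<^sup>L P X"
    by (simp add: prob_space)
  also have "\<dots> \<le> \<alpha> + \<beta> * upper_exp Ps X"
    using assms P by (intro add_left_mono mult_left_mono integral_le_upper_exp)
  finally show "integral\<^sup>L P Y \<le> \<alpha> + \<beta> * upper_exp Ps X" .
qed

text \<open>Without mean uncertainty, each measure of the family integrates the variable to zero.\<close>

lemma integral_eq_0:
  assumes "Y \<in> H" "upper_exp Ps Y = 0" "upper_exp Ps (\<lambda>\<omega>. - Y \<omega>) = 0" "P \<in> Ps"
  shows "integral\<^sup>L P Y = 0"
proof -
  have "(\<lambda>\<omega>. - Y \<omega>) \<in> H"
    using H_scale[OF assms(1), of "-1"] by simp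
  then show ?thesis
    using integral_le_upper_exp[OF assms(1,4)] integral_le_upper_exp[of "\<lambda>\<omega>. - Y \<omega>" P] assms
    by simp
qed

text \<open>
  One step of the moment recursion with the past frozen at the value $s$. The coefficient $\gamma$
  may depend on $s$ and have either sign; it disappears because the mean of $Y$ is zero under every
  $P$.
\<close>

lemma upper_exp_abs_powr_shift_le:
  assumes bound: "\<And>y. \<bar>s + y\<bar> powr r \<le> \<alpha> + \<gamma> * y + \<beta> * \<bar>y\<bar> powr r"
    and r: "r \<ge> 1" and \<beta>: "\<beta> \<ge> 0" and Y: "Y \<in> H"
    and mean: "upper_exp Ps Y = 0" "upper_exp Ps (\<lambda>\<omega>. - Y \<omega>) = 0"
  shows "upper_exp Ps (\<lambda>\<omega>. \<bar>s + Y \<omega>\<bar> powr r) \<le> \<alpha> + \<beta> * upper_exp Ps (\<lambda>\<omega>. \<bar>Y \<omega>\<bar> powr r)"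
proof (rule upper_exp_le)
  fix P assume P: "P \<in> Ps"
  interpret prob_space P
    using P by (rule Ps_prob)
  have Yr: "(\<lambda>\<omega>. \<bar>Y \<omega>\<bar> powr r) \<in> H"
    using Y r by (rule H_abs_powr)
  note [simp] = H_integrable[OF Y P] H_integrable[OF Yr P]
  have "(\<integral>\<omega>. \<bar>s + Y \<omega>\<bar> powr r \<partial>P) \<le> (\<integral>\<omega>. \<alpha> + \<gamma> * Y \<omega> + \<beta> * \<bar>Y \<omega>\<bar> powr r \<partial>P)"
  proof (rule integral_mono)
    show "integrable P (\<lambda>\<omega>. \<bar>s + Y \<omega>\<bar> powr r)"
      by (intro H_integrable H_abs_powr H_add H_const Y r P)
  qed (use bound in auto)
  also have "\<dots> = \<alpha> + \<gamma> * integral\<^sup>L P Y + \<beta> * (\<integral>\<omega>. \<bar>Y \<omega>\<bar> powr r \<partial>P)"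
    by (simp add: prob_space)
  also have "\<dots> = \<alpha> + \<beta> * (\<integral>\<omega>. \<bar>Y \<omega>\<bar> powr r \<partial>P)"
    using integral_eq_0[OF Y mean P] by simp
  also have "\<dots> \<le> \<alpha> + \<beta> * upper_exp Ps (\<lambda>\<omega>. \<bar>Y \<omega>\<bar> powr r)"
    using \<beta> Yr P by (intro add_left_mono mult_left_mono integral_le_upper_exp)
  finally show "(\<integral>\<omega>. \<bar>s + Y \<omega>\<bar> powr r \<partial>P) \<le> \<alpha> + \<beta> * upper_exp Ps (\<lambda>\<omega>. \<bar>Y \<omega>\<bar> powr r)" .
qed

section \<open>Moments of block sums of an IID sequence\<close>

text \<open>
  Independence applied to the function $|x_{m+1}+\dots+x_k+x_{k+1}|^r$ of the first $k+1$
  variables, which ignores those up to index $m$. The inner expectation then depends on the past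
  only through the block sum, which makes the estimates uniform in $m$.
\<close>

lemma independent_abs_powr_block:
  assumes X: "\<And>i. i \<ge> 1 \<Longrightarrow> X i \<in> H" and Y: "Y \<in> H" and r: "r \<ge> 1"
    and ind: "independent_of Ps H k X Y"
  defines "g \<equiv> \<lambda>s. upper_exp Ps (\<lambda>\<omega>. \<bar>s + Y \<omega>\<bar> powr r)"
  shows "(\<lambda>\<omega>. g (\<Sum>i\<in>{m<..k}. X i \<omega>)) \<in> H"
    and "upper_exp Ps (\<lambda>\<omega>. \<bar>(\<Sum>i\<in>{m<..k}. X i \<omega>) + Y \<omega>\<bar> powr r)
           = upper_exp Ps (\<lambda>\<omega>. g (\<Sum>i\<in>{m<..k}. X i \<omega>))"
proof -
  define \<phi> :: "(nat \<Rightarrow> real) \<Rightarrow> real"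
    where "\<phi> x = \<bar>(\<Sum>i\<in>{m<..k}. x i) + x (Suc k)\<bar> powr r" for x
  have "\<phi> \<in> borel_measurable (borel_vec (Suc k))"
    unfolding \<phi>_def by measurable
  have upd: "\<phi> (x(Suc k := y)) = \<bar>(\<Sum>i\<in>{m<..k}. x i) + y\<bar> powr r" for x y
    by (simp add: \<phi>_def)
  have sum: "(\<Sum>i\<in>{m<..k}. rvec k X \<omega> i) = (\<Sum>i\<in>{m<..k}. X i \<omega>)" for \<omega>
    by (intro sum.cong) (auto simp: rvec_def)
  have "(\<lambda>\<omega>. \<phi> ((rvec k X \<omega>)(Suc k := Y \<omega>))) \<in> H"
    unfolding upd sum by (intro H_abs_powr H_add H_sum X Y r) auto
  moreover have "\<forall>x\<in>{1..k} \<rightarrow>\<^sub>E UNIV. (\<lambda>\<omega>. \<phi> (x(Suc k := Y \<omega>))) \<in> H"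
    unfolding upd by (intro ballI H_abs_powr H_add H_const Y r)
  ultimately show "(\<lambda>\<omega>. g (\<Sum>i\<in>{m<..k}. X i \<omega>)) \<in> H"
    and "upper_exp Ps (\<lambda>\<omega>. \<bar>(\<Sum>i\<in>{m<..k}. X i \<omega>) + Y \<omega>\<bar> powr r)
           = upper_exp Ps (\<lambda>\<omega>. g (\<Sum>i\<in>{m<..k}. X i \<omega>))"
    using ind \<open>\<phi> \<in> _\<close> unfolding independent_of_def Let_def g_def upd
    by (auto simp: upd sum simp del: fun_upd_apply)
qed

lemma iid_upper_exp_eq:
  assumes "iid Ps H X" "i \<ge> 1" "\<phi> \<in> borel_measurable borel"
    and "(\<lambda>\<omega>. \<phi> (X i \<omega>)) \<in> H" "(\<lambda>\<omega>. \<phi> (X 1 \<omega>)) \<in> H"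
  shows "upper_exp Ps (\<lambda>\<omega>. \<phi> (X i \<omega>)) = upper_exp Ps (\<lambda>\<omega>. \<phi> (X 1 \<omega>))"
  using assms unfolding iid_def identically_distributed_def by blast

text \<open>
  Iterating the one-step bound. The induction starts at $n=1$ rather than at the empty block, where
  $1/n$ would be meaningless and, for $m=0$, independence of an empty past would be required.
\<close>

lemma iid_block_moment_le:
  assumes X: "\<And>i. i \<ge> 1 \<Longrightarrow> X i \<in> H" and iid: "iid Ps H X"
    and mean: "upper_exp Ps (X 1) = 0" "upper_exp Ps (\<lambda>\<omega>. - X 1 \<omega>) = 0"
    and r: "r > 2"
  obtains K where "K > 0"
    and "\<And>m n. n \<ge> 1 \<Longrightarrow>
           upper_exp Ps (\<lambda>\<omega>. \<bar>\<Sum>i\<in>{m<..m + n}. X i \<omega>\<bar> powr r) \<le> K * real n powr (r / 2)"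
proof -
  obtain C where C: "C \<ge> 0"
    and expand: "\<And>n s y. n \<ge> 1 \<Longrightarrow> \<bar>s + y\<bar> powr r
           \<le> (1 + 1 / n) * \<bar>s\<bar> powr r + r * sgn s * \<bar>s\<bar> powr (r - 1) * y
             + C * n powr (r / 2 - 1) * \<bar>y\<bar> powr r"
    using abs_powr_add_le[OF r] by blast
  define \<rho> where "\<rho> = upper_exp Ps (\<lambda>\<omega>. \<bar>X 1 \<omega>\<bar> powr r)"
  have Xr: "(\<lambda>\<omega>. \<bar>X i \<omega>\<bar> powr r) \<in> H" if "i \<ge> 1" for i
    using X[OF that] r by (intro H_abs_powr) auto
  have Xneg: "(\<lambda>\<omega>. - X i \<omega>) \<in> H" if "i \<ge> 1" for i
    using H_scale[OF X[OF that], of "-1"] by simp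
  have \<rho>: "\<rho> \<ge> 0"
    unfolding \<rho>_def by (intro upper_exp_nonneg Xr) auto
  have \<rho>_eq: "upper_exp Ps (\<lambda>\<omega>. \<bar>X i \<omega>\<bar> powr r) = \<rho>" if "i \<ge> 1" for i
    unfolding \<rho>_def using that by (intro iid_upper_exp_eq[OF iid] Xr) auto
  have mean_i: "upper_exp Ps (X i) = 0" "upper_exp Ps (\<lambda>\<omega>. - X i \<omega>) = 0" if "i \<ge> 1" for i
    using iid_upper_exp_eq[OF iid that, of "\<lambda>x. x"] iid_upper_exp_eq[OF iid that, of uminus]
      mean X Xneg that by auto
  define a where "a m n = upper_exp Ps (\<lambda>\<omega>. \<bar>\<Sum>i\<in>{m<..m + n}. X i \<omega>\<bar> powr r)" for m n
  have a_1: "a m 1 \<le> \<rho>" for m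
    using \<rho>_eq[of "Suc m"] by (simp add: a_def flip: atLeastSucAtMost_greaterThanAtMost)
  have a_Suc: "a m (Suc n) \<le> (1 + 1 / n) * a m n + C * \<rho> * n powr (r / 2 - 1)"
    if n: "n \<ge> 1" for m n
  proof -
    define S where "S \<omega> = (\<Sum>i\<in>{m<..m + n}. X i \<omega>)" for \<omega>
    define Y where "Y = X (Suc (m + n))"
    define g where "g s = upper_exp Ps (\<lambda>\<omega>. \<bar>s + Y \<omega>\<bar> powr r)" for s
    have Y: "Y \<in> H" "upper_exp Ps Y = 0" "upper_exp Ps (\<lambda>\<omega>. - Y \<omega>) = 0"
        "upper_exp Ps (\<lambda>\<omega>. \<bar>Y \<omega>\<bar> powr r) = \<rho>"
      unfolding Y_def by (auto intro: X mean_i \<rho>_eq)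
    have S: "S \<in> H"
      unfolding S_def by (intro H_sum X) auto
    have ind: "independent_of Ps H (m + n) X Y"
      using iid n unfolding iid_def Y_def by auto
    note gS = independent_abs_powr_block[OF X Y(1) _ ind, of r m, folded g_def S_def]
    have g: "g s \<le> C * n powr (r / 2 - 1) * \<rho> + (1 + 1 / n) * \<bar>s\<bar> powr r" for s
      using upper_exp_abs_powr_shift_le[OF expand[of "real n" s] _ _ Y(1-3)] n r C
      by (simp add: g_def Y(4))
    have "{m<..m + Suc n} = insert (Suc (m + n)) {m<..m + n}"
      by auto
    then have "a m (Suc n) = upper_exp Ps (\<lambda>\<omega>. \<bar>S \<omega> + Y \<omega>\<bar> powr r)"
      by (simp add: a_def S_def Y_def add.commute)
    also have "\<dots> = upper_exp Ps (\<lambda>\<omega>. g (S \<omega>))"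
      using gS(2) r by simp
    also have "\<dots> \<le> C * n powr (r / 2 - 1) * \<rho> + (1 + 1 / n) * upper_exp Ps (\<lambda>\<omega>. \<bar>S \<omega>\<bar> powr r)"
      using gS(1) r g S by (intro upper_exp_affine_le H_abs_powr) auto
    finally show ?thesis
      by (simp add: a_def S_def algebra_simps)
  qed
  define K where "K = max (max \<rho> (C * \<rho> / (r / 2 - 1))) 1"
  have "a m n \<le> K * n powr (r / 2)" if "n \<ge> 1" for m n
    using growth_from_recursion[of r "C * \<rho>" "a m" \<rho> K n] r C \<rho> a_1 a_Suc that
    by (auto simp: K_def)
  moreover have "K > 0"
    by (simp add: K_def)
  ultimately show thesis
    using that unfolding a_def by blast
qed

end

theorem theorem3p1:
  fixes M :: "'a measure" and Ps :: "'a measure set" and H :: "('a \<Rightarrow> real) set"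
    and X :: "nat \<Rightarrow> 'a \<Rightarrow> real" and r :: real
  assumes "upper_expectation_space M Ps H"
    and "\<And>i. i \<ge> 1 \<Longrightarrow> X i \<in> H"
    and "iid Ps H X"
    and "upper_exp Ps (X 1) = 0"
    and "upper_exp Ps (\<lambda>\<omega>. - X 1 \<omega>) = 0"
    and "r > 2"
  shows "\<exists>K>0. \<forall>n::nat. n \<ge> 1 \<longrightarrow>
           (SUP m::nat. ereal (upper_exp Ps
              (\<lambda>\<omega>. \<bar>partial_sum X (m + n) \<omega> - partial_sum X m \<omega>\<bar> powr r)))
           \<le> ereal (K * real n powr (r / 2))"
proof -
  interpret upper_expectation_space M Ps H
    by fact
  obtain K where K: "K > 0"
    and bound: "\<And>m n. n \<ge> 1 \<Longrightarrow>
           upper_exp Ps (\<lambda>\<omega>. \<bar>\<Sum>i\<in>{m<..m + n}. X i \<omega>\<bar> powr r) \<le> K * real n powr (r / 2)"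
    using iid_block_moment_le[OF assms(2-6)] by blast
  have block: "partial_sum X (m + n) \<omega> - partial_sum X m \<omega> = (\<Sum>i\<in>{m<..m + n}. X i \<omega>)" for m n \<omega>
  proof -
    have "{1..m + n} = {1..m} \<union> {m<..m + n}" "{1..m} \<inter> {m<..m + n} = {}"
      by auto
    then have "partial_sum X (m + n) \<omega> = partial_sum X m \<omega> + (\<Sum>i\<in>{m<..m + n}. X i \<omega>)"
      unfolding partial_sum_def by (metis finite_atLeastAtMost finite_greaterThanAtMost sum.union_disjoint)
    then show ?thesis
      by simp
  qed
  show ?thesis
    using K bound by (intro exI[of _ K]) (auto simp: block intro!: SUP_least)
qed

end
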